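(* Let $n\ge1$, let $\mathcal{C}\subset\mathbb{H}^n$ be a convex set, let $f:\mathcal{C}\to\mathbb{R}$ be second-order continuously real-differentiable, and let $\sigma>0$. Then $f$ is $\sigma$-strongly convex if and only if $$\boldsymbol{H}_{\mathcal{H}\mathcal{H}^*}\succeq\frac{\sigma}{4}\boldsymbol{I}_{4n}$$ at every point $\boldsymbol{q}\in\mathcal{C}$, where $\boldsymbol{H}_{\mathcal{H}\mathcal{H}^*}\in\mathbb{H}^{4n\times4n}$ is the augmented quaternion Hessian matrix of $f$ and $\boldsymbol{I}_{4n}$ is the identity matrix.
   Context: $\mathbb{H}$ is the algebra of real quaternions $q=q_a+q_bi+q_cj+q_dk$ ($i^2=j^2=k^2=ijk=-1$), $\mathrm{Re}\{q\}=q_a$, $q^*=q_a-q_bi-q_cj-q_dk$; $(\cdot)^{\mathsf{H}}$ is the conjugate transpose, $\|\boldsymbol{q}\|_2=\sqrt{\boldsymbol{q}^{\mathsf{H}}\boldsymbol{q}}$. For nonzero $\mu\in\mathbb{H}$, $q^\mu=\mu q\mu^{-1}$, and $q^{\mu*}=(q^\mu)^*$. A set $\mathcal{C}\subset\mathbb{H}^n$ is convex if it is closed under $\theta\boldsymbol{x}+(1-\theta)\boldsymbol{y}$, $0\le\theta\le1$ real. For $\sigma>0$, $f:\mathcal{C}\to\mathbb{R}$ is $\sigma$-strongly convex if for all $\boldsymbol{p},\boldsymbol{q}\in\mathcal{C}$ and $\theta\in(0,1)$, $f(\theta\boldsymbol{p}+(1-\theta)\boldsymbol{q})\le\theta f(\boldsymbol{p})+(1-\theta)f(\boldsymbol{q})-\frac{\sigma}{2}\theta(1-\theta)\|\boldsymbol{p}-\boldsymbol{q}\|_2^2$.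 Second-order continuously real-differentiable means that $f$, as a function of the $4n$ real components of $\boldsymbol{q}$, is twice continuously differentiable at every point of $\mathcal{C}$ ($f$ is defined only on $\mathcal{C}$, so partial derivatives at points of $\mathcal{C}$ are the usual two-sided ones computed from values on $\mathcal{C}$). GHR derivatives: for a real-differentiable $\mathbb{H}$-valued (in particular real-valued) function $g$ of $\boldsymbol{q}=(q_1,\dots,q_n)^{\mathsf{T}}$ with $q_l=q_{l,a}+q_{l,b}i+q_{l,c}j+q_{l,d}k$, and nonzero $\mu\in\mathbb{H}$, $$\frac{\partial g}{\partial q_l^{\mu}}=\frac14\left(\frac{\partial g}{\partial q_{l,a}}-\frac{\partial g}{\partial q_{l,b}}i^\mu-\frac{\partial g}{\partial q_{l,c}}j^\mu-\frac{\partial g}{\partial q_{l,d}}k^\mu\right),\quad \frac{\partial g}{\partial q_l^{\mu*}}=\frac14\left(\frac{\partial g}{\partial q_{l,a}}+\frac{\partial g}{\partial q_{l,b}}i^\mu+\frac{\partial g}{\partial q_{l,c}}j^\mu+\frac{\partial g}{\partial q_{l,d}}k^\mu\right),$$ where the partial derivatives (in $\mathbb{H}$) multiply from the left. For $\mu,\nu\in\{1,i,j,k\}$, $\boldsymbol{H}_{\boldsymbol{q}^\nu\boldsymbol{q}^{\mu*}}=\frac{\partial}{\partial\boldsymbol{q}^\nu}\left(\frac{\partial f}{\partial\boldsymbol{q}^{\mu*}}\right)^{\mathsf{T}}\in\mathbb{H}^{n\times n}$ is the matrix whose $(m,l)$ entry is $\frac{\partial}{\partial q_l^\nu}\left(\frac{\partial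 f}{\partial q_m^{\mu*}}\right)$. The augmented quaternion Hessian $\boldsymbol{H}_{\mathcal{H}\mathcal{H}^*}\in\mathbb{H}^{4n\times4n}$ is the $4\times4$ block matrix whose block in row $\mu$ and column $\nu$ (rows and columns ordered $1,i,j,k$) is $\boldsymbol{H}_{\boldsymbol{q}^\nu\boldsymbol{q}^{\mu*}}$. A matrix $\boldsymbol{A}\in\mathbb{H}^{N\times N}$ is positive semi-definite, written $\boldsymbol{A}\succeq\boldsymbol{O}$, if $\mathrm{Re}\{\boldsymbol{x}^{\mathsf{H}}\boldsymbol{A}\boldsymbol{x}\}\ge0$ for all nonzero $\boldsymbol{x}\in\mathbb{H}^N$; $\boldsymbol{A}\succeq\boldsymbol{B}$ means $\boldsymbol{A}-\boldsymbol{B}\succeq\boldsymbol{O}$. *)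

theory Defs
  imports "HOL-Analysis.Analysis"
begin

section \<open>Real quaternions\<close>

datatype quat = Quat (qa: real) (qb: real) (qc: real) (qd: real)

lemma quat_eq_iff: "p = q \<longleftrightarrow> qa p = qa q \<and> qb p = qb q \<and> qc p = qc q \<and> qd p = qd q"
  by (cases p; cases q) auto

instantiation quat :: ab_group_add
begin
definition "0 = Quat 0 0 0 0"
definition "p + q = Quat (qa p + qa q) (qb p + qb q) (qc p + qc q) (qd p + qd q)"
definition "- q = Quat (- qa q) (- qb q) (- qc q) (- qd q)"
definition "p - q = Quat (qa p - qa q) (qb p - qb q) (qc p - qc q) (qd p - qd q)"
instance
  by standard (auto simp: zero_quat_def plus_quat_def uminus_quat_def minus_quat_def)
end

lemma quat_add_sel [simp]:
  "qa (p + q) = qa p + qa q" "qb (p + q) = qb p + qb q"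
  "qc (p + q) = qc p + qc q" "qd (p + q) = qd p + qd q"
  "qa 0 = 0" "qb 0 = 0" "qc 0 = 0" "qd 0 = 0"
  "qa (- q) = - qa q" "qb (- q) = - qb q" "qc (- q) = - qc q" "qd (- q) = - qd q"
  "qa (p - q) = qa p - qa q" "qb (p - q) = qb p - qb q"
  "qc (p - q) = qc p - qc q" "qd (p - q) = qd p - qd q"
  by (auto simp: zero_quat_def plus_quat_def uminus_quat_def minus_quat_def)

instantiation quat :: ring_1
begin
definition "1 = Quat 1 0 0 0"
definition "p * q = Quat
  (qa p * qa q - qb p * qb q - qc p * qc q - qd p * qd q)
  (qa p * qb q + qb p * qa q + qc p * qd q - qd p * qc q)
  (qa p * qc q - qb p * qd q + qc p * qa q + qd p * qb q)
  (qa p * qd q + qb p * qc q - qc p * qb q + qd p * qa q)"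
instance
  by standard (auto simp: quat_eq_iff one_quat_def times_quat_def algebra_simps)
end

lemma quat_mult_sel [simp]:
  "qa 1 = 1" "qb 1 = 0" "qc 1 = 0" "qd 1 = 0"
  "qa (p * q) = qa p * qa q - qb p * qb q - qc p * qc q - qd p * qd q"
  "qb (p * q) = qa p * qb q + qb p * qa q + qc p * qd q - qd p * qc q"
  "qc (p * q) = qa p * qc q - qb p * qd q + qc p * qa q + qd p * qb q"
  "qd (p * q) = qa p * qd q + qb p * qc q - qc p * qb q + qd p * qa q"
  by (auto simp: one_quat_def times_quat_def)

instantiation quat :: real_algebra_1
begin
definition "r *\<^sub>R q = Quat (r * qa q) (r * qb q) (r * qc q) (r * qd q)"
instance
  by standard (auto simp: quat_eq_iff scaleR_quat_def algebra_simps)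
end

lemma quat_scaleR_sel [simp]:
  "qa (r *\<^sub>R q) = r * qa q" "qb (r *\<^sub>R q) = r * qb q"
  "qc (r *\<^sub>R q) = r * qc q" "qd (r *\<^sub>R q) = r * qd q"
  by (auto simp: scaleR_quat_def)

instantiation quat :: real_inner
begin
definition "inner p q = qa p * qa q + qb p * qb q + qc p * qc q + qd p * qd q"
definition "norm q = sqrt ((qa q)\<^sup>2 + (qb q)\<^sup>2 + (qc q)\<^sup>2 + (qd q)\<^sup>2)"
definition "sgn q = q /\<^sub>R norm (q :: quat)"
definition "dist p q = norm (p - q :: quat)"
definition [code del]:
  "(uniformity :: (quat \<times> quat) filter) = (INF e\<in>{0<..}. principal {(x, y). dist x y < e})"
definition [code del]:
  "open (U :: quat set) \<longleftrightarrow> (\<forall>x\<in>U. \<forall>\<^sub>F (x', y) in uniformity. x' = x \<longrightarrow> y \<in> U)"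
instance
proof
  fix p q r :: quat and s :: real and U :: "quat set"
  show "dist p q = norm (p - q)"
    by (rule dist_quat_def)
  show "sgn q = q /\<^sub>R norm q"
    by (rule sgn_quat_def)
  show "uniformity = (INF e\<in>{0<..}. principal {(x, y). dist (x::quat) y < e})"
    by (rule uniformity_quat_def)
  show "open U \<longleftrightarrow> (\<forall>x\<in>U. \<forall>\<^sub>F (x', y) in uniformity. x' = x \<longrightarrow> y \<in> U)"
    by (rule open_quat_def)
  show "p \<bullet> q = q \<bullet> p"
    by (simp add: inner_quat_def mult.commute)
  show "(p + q) \<bullet> r = p \<bullet> r + q \<bullet> r"
    by (simp add: inner_quat_def algebra_simps)
  show "(s *\<^sub>R p) \<bullet> q = s * (p \<bullet> q)"
    by (simp add: inner_quat_def algebra_simps)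
  show "0 \<le> p \<bullet> p"
    by (simp add: inner_quat_def)
  show "p \<bullet> p = 0 \<longleftrightarrow> p = 0"
  proof
    assume "p \<bullet> p = 0"
    hence "(qa p)\<^sup>2 + (qb p)\<^sup>2 + (qc p)\<^sup>2 + (qd p)\<^sup>2 = 0"
      by (simp add: inner_quat_def power2_eq_square)
    moreover have "(qa p)\<^sup>2 \<ge> 0" "(qb p)\<^sup>2 \<ge> 0" "(qc p)\<^sup>2 \<ge> 0" "(qd p)\<^sup>2 \<ge> 0"
      by auto
    ultimately have "(qa p)\<^sup>2 = 0" "(qb p)\<^sup>2 = 0" "(qc p)\<^sup>2 = 0" "(qd p)\<^sup>2 = 0"
      by linarith+
    thus "p = 0" by (simp add: quat_eq_iff)
  qed (simp add: inner_quat_def)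
  show "norm p = sqrt (p \<bullet> p)"
    by (simp add: norm_quat_def inner_quat_def power2_eq_square)
qed
end

definition qcnj :: "quat \<Rightarrow> quat" where
  "qcnj q = Quat (qa q) (- qb q) (- qc q) (- qd q)"

lemma qcnj_sel [simp]:
  "qa (qcnj q) = qa q" "qb (qcnj q) = - qb q" "qc (qcnj q) = - qc q" "qd (qcnj q) = - qd q"
  by (auto simp: qcnj_def)

lemma qcnj_mult_self: "qcnj q * q = of_real ((norm q)\<^sup>2)" "q * qcnj q = of_real ((norm q)\<^sup>2)"
  by (auto simp: quat_eq_iff norm_quat_def of_real_def power2_eq_square)

instantiation quat :: real_normed_div_algebra
begin
definition "inverse q = qcnj q /\<^sub>R (norm q)\<^sup>2"
definition "p div (q :: quat) = p * inverse q"
instance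
proof
  fix p q :: quat
  show "q \<noteq> 0 \<Longrightarrow> inverse q * q = 1"
    unfolding inverse_quat_def mult_scaleR_left qcnj_mult_self by (simp add: of_real_def)
  show "q \<noteq> 0 \<Longrightarrow> q * inverse q = 1"
    unfolding inverse_quat_def mult_scaleR_right qcnj_mult_self by (simp add: of_real_def)
  show "p div q = p * inverse q"
    by (rule divide_quat_def)
  show "inverse (0 :: quat) = 0"
    by (simp add: inverse_quat_def quat_eq_iff)
  show "norm (p * q) = norm p * norm q"
    by (simp add: norm_quat_def flip: real_sqrt_mult) algebra
qed
end

definition quat_i :: quat where "quat_i = Quat 0 1 0 0"
definition quat_j :: quat where "quat_j = Quat 0 0 1 0"
definition quat_k :: quat where "quat_k = Quat 0 0 0 1"

lemma quat_relations:
  "quat_i * quat_i = -1" "quat_j * quat_j = -1" "quat_k * quat_k = -1"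
  "quat_i * quat_j * quat_k = -1"
  by (auto simp: quat_eq_iff quat_i_def quat_j_def quat_k_def)

lemma quat_decomp:
  "q = of_real (qa q) + of_real (qb q) * quat_i + of_real (qc q) * quat_j + of_real (qd q) * quat_k"
  by (simp add: quat_eq_iff quat_i_def quat_j_def quat_k_def of_real_def)

definition qrot :: "quat \<Rightarrow> quat \<Rightarrow> quat" where
  "qrot \<mu> q = \<mu> * q * inverse \<mu>"

text \<open>Indexes both the four real components of a quaternion and the four blocks of augmented
  vectors and matrices.\<close>

datatype qidx = Idx_1 | Idx_i | Idx_j | Idx_k

lemma UNIV_qidx: "UNIV = {Idx_1, Idx_i, Idx_j, Idx_k}"
  using qidx.exhaust by auto

instance qidx :: finite
  by standard (simp add: UNIV_qidx)

primrec qunit :: "qidx \<Rightarrow> quat" where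
  "qunit Idx_1 = 1"
| "qunit Idx_i = quat_i"
| "qunit Idx_j = quat_j"
| "qunit Idx_k = quat_k"


section \<open>Real differentiability\<close>

text \<open>The partial derivative with respect to the real component of \<open>q\<^sub>l\<close> along the quaternion
  unit \<open>u\<close>.\<close>

definition real_partial ::
  "(quat^'n \<Rightarrow> 'b::real_normed_vector) \<Rightarrow> 'n::finite \<Rightarrow> qidx \<Rightarrow> quat^'n \<Rightarrow> 'b" where
  "real_partial g l u q =
     vector_derivative (\<lambda>t::real. g (q + axis l (t *\<^sub>R qunit u))) (at 0)"

text \<open>Functions on \<open>C\<close> are represented by total functions. A two-sided partial derivative at a
  point \<open>q\<close> of \<open>C\<close> that is computed from the values on \<open>C\<close> alone requires \<open>C\<close> to contain all
  points of the coordinate line through \<open>q\<close> which are close to \<open>q\<close>.\<close>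

definition has_real_partial_in ::
  "(quat^'n) set \<Rightarrow> (quat^'n \<Rightarrow> 'b::real_normed_vector) \<Rightarrow> 'n::finite \<Rightarrow> qidx \<Rightarrow> quat^'n \<Rightarrow> bool"
  where
  "has_real_partial_in C g l u q \<longleftrightarrow>
     (\<forall>\<^sub>F t in at (0::real). q + axis l (t *\<^sub>R qunit u) \<in> C) \<and>
     (\<lambda>t::real. g (q + axis l (t *\<^sub>R qunit u))) differentiable (at 0)"

definition real_C1_on ::
  "(quat^'n) set \<Rightarrow> (quat^'n::finite \<Rightarrow> 'b::real_normed_vector) \<Rightarrow> bool" where
  "real_C1_on C g \<longleftrightarrow>
     (\<forall>l u. (\<forall>q\<in>C. has_real_partial_in C g l u q) \<and> continuous_on C (real_partial g l u))"

definition real_C2_on ::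
  "(quat^'n) set \<Rightarrow> (quat^'n::finite \<Rightarrow> 'b::real_normed_vector) \<Rightarrow> bool" where
  "real_C2_on C f \<longleftrightarrow> real_C1_on C f \<and> (\<forall>l u. real_C1_on C (real_partial f l u))"


section \<open>GHR derivatives and the augmented quaternion Hessian\<close>

definition ghr :: "(quat^'n \<Rightarrow> quat) \<Rightarrow> 'n::finite \<Rightarrow> quat \<Rightarrow> quat^'n \<Rightarrow> quat" where
  "ghr g l \<mu> q = (1/4) *\<^sub>R
     (real_partial g l Idx_1 q
      - real_partial g l Idx_i q * qrot \<mu> quat_i
      - real_partial g l Idx_j q * qrot \<mu> quat_j
      - real_partial g l Idx_k q * qrot \<mu> quat_k)"

definition ghr_conj :: "(quat^'n \<Rightarrow> quat) \<Rightarrow> 'n::finite \<Rightarrow> quat \<Rightarrow> quat^'n \<Rightarrow> quat" where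
  "ghr_conj g l \<mu> q = (1/4) *\<^sub>R
     (real_partial g l Idx_1 q
      + real_partial g l Idx_i q * qrot \<mu> quat_i
      + real_partial g l Idx_j q * qrot \<mu> quat_j
      + real_partial g l Idx_k q * qrot \<mu> quat_k)"

text \<open>\<open>quat_hessian f \<nu> \<mu> q\<close> is \<open>H\<^bsub>q\<^sup>\<nu> q\<^sup>\<mu>\<^sup>*\<^esub>\<close>: the conjugate derivative, with respect to the
  row variable, is taken first.\<close>

definition quat_hessian ::
  "(quat^'n \<Rightarrow> real) \<Rightarrow> quat \<Rightarrow> quat \<Rightarrow> quat^'n \<Rightarrow> quat^'n^'n::finite" where
  "quat_hessian f \<nu> \<mu> q = (\<chi> m l. ghr (ghr_conj (\<lambda>p. of_real (f p)) m \<mu>) l \<nu> q)"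

text \<open>The \<open>4n \<times> 4n\<close> matrix has rows and columns indexed by pairs of a block and a position
  within the block.\<close>

definition aug_hessian ::
  "(quat^'n \<Rightarrow> real) \<Rightarrow> quat^'n \<Rightarrow> quat^(qidx \<times> 'n)^(qidx \<times> 'n::finite)" where
  "aug_hessian f q =
     (\<chi> r c. quat_hessian f (qunit (fst c)) (qunit (fst r)) q $ snd r $ snd c)"


section \<open>Positive semi-definiteness and strong convexity\<close>

definition hdot :: "quat^'m \<Rightarrow> quat^'m::finite \<Rightarrow> quat" where
  "hdot x y = (\<Sum>i\<in>UNIV. qcnj (x $ i) * y $ i)"

text \<open>The library norm on \<open>quat^'m\<close> is the norm \<open>\<parallel>x\<parallel>\<^sub>2 = sqrt (x\<^sup>H x)\<close>.\<close>

lemma hdot_self: "hdot x x = of_real ((norm x)\<^sup>2)"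
proof -
  have "(norm x)\<^sup>2 = (\<Sum>i\<in>UNIV. (norm (x $ i))\<^sup>2)"
    by (simp add: norm_vec_def L2_set_def sum_nonneg)
  thus ?thesis
    by (simp add: hdot_def qcnj_mult_self)
qed

definition quat_psd :: "quat^'m^'m::finite \<Rightarrow> bool" where
  "quat_psd A \<longleftrightarrow> (\<forall>x. x \<noteq> 0 \<longrightarrow> qa (hdot x (A *v x)) \<ge> 0)"

definition loewner_ge :: "quat^'m^'m::finite \<Rightarrow> quat^'m^'m \<Rightarrow> bool" (infix "\<succeq>\<^sub>L" 50) where
  "A \<succeq>\<^sub>L B \<longleftrightarrow> quat_psd (A - B)"

definition strongly_convex_on ::
  "real \<Rightarrow> 'a::real_normed_vector set \<Rightarrow> ('a \<Rightarrow> real) \<Rightarrow> bool" where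
  "strongly_convex_on \<sigma> C f \<longleftrightarrow>
     (\<forall>p\<in>C. \<forall>q\<in>C. \<forall>\<theta>\<in>{0<..<1}.
        f (\<theta> *\<^sub>R p + (1 - \<theta>) *\<^sub>R q)
          \<le> \<theta> * f p + (1 - \<theta>) * f q - \<sigma> / 2 * \<theta> * (1 - \<theta>) * (norm (p - q))\<^sup>2)"

end

theory Submission
  imports Defs
begin

text \<open>
  The quaternion Hessian is the ordinary real Hessian in other coordinates, up to a scaling that
  accounts for the constant \<open>\<sigma> / 4\<close>. For a unit \<open>a\<close> write \<open>a\<^sup>\<mu> = \<mu> a \<mu>\<^sup>-\<^sup>1\<close>, which is
  \<open>\<plusminus>a\<close>. Unfolding the two GHR derivatives gives the entry of the augmented Hessian in row
  \<open>(\<mu>, m)\<close> and column \<open>(\<nu>, l)\<close> as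

  \<open>1/16 \<Sum>\<^sub>a\<^sub>,\<^sub>b R m a l b \<cdot> a\<^sup>\<mu> (b\<^sup>\<nu>)\<^sup>*\<close>  (\<open>aug_hessian_entry\<close>),

  where \<open>R m a l b\<close> is the second real partial derivative along component \<open>a\<close> of \<open>q\<^sub>m\<close> and
  component \<open>b\<close> of \<open>q\<^sub>l\<close>. So \<open>x\<^sup>H H x\<close> is \<open>1/16\<close> of the form \<open>R\<close> evaluated at the
  quaternion vector \<open>w m a = \<Sum>\<^sub>\<mu> (a\<^sup>\<mu>)\<^sup>* x\<^sub>\<mu>\<^sub>m\<close> (\<open>aug_hessian_quadratic_form\<close>). The signs in
  \<open>a\<^sup>\<mu> = \<plusminus>a\<close> form a \<open>4 \<times> 4\<close> Hadamard matrix, hence \<open>x \<mapsto> w\<close> is onto and satisfies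
  \<open>\<parallel>w\<parallel>\<^sup>2 = 4 \<parallel>x\<parallel>\<^sup>2\<close> (\<open>unmix_surj_real\<close>, \<open>sum_norm_unmix\<close>). The Hessian condition
  thus reads \<open>R(w) \<ge> \<sigma> \<parallel>w\<parallel>\<^sup>2\<close> for all quaternion vectors \<open>w\<close>. Since \<open>R\<close> is real, its value at
  \<open>w\<close> is the sum of its values at the four real component vectors of \<open>w\<close>, so the condition says
  that the real Hessian is at least \<open>\<sigma> I\<close> (\<open>quadratic_form_bound_quat_iff_real\<close>).

  The remaining part is the classical second-order criterion for strong convexity on an open convex
  set (\<open>strongly_convex_on_iff_second_partials\<close>). It is obtained by subtracting
  \<open>\<sigma>/2 \<parallel>q\<parallel>\<^sup>2\<close>, restricting to lines, and using that a function of one variable is convex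
  exactly when its second derivative is nonnegative. Continuity of the partial derivatives enters
  through the chain rule along non-coordinate lines. The set \<open>C\<close> is indeed open: around each of its
  points it contains a piece of every coordinate line, and by convexity the cross-polytope spanned by
  these pieces (\<open>open_if_convex_and_coordinate_lines\<close>).
\<close>

section \<open>Second-order calculus on Euclidean spaces\<close>

text \<open>The increment is split along the coordinate directions, one at a time. The mean value
  estimate for each piece replaces the partial derivative near \<open>q\<close> by its value at \<open>q\<close>, at the cost
  of an error that continuity makes small.\<close>

lemma continuous_partials_imp_has_derivative:
  fixes f :: "'a::euclidean_space \<Rightarrow> real" and D :: "'a \<Rightarrow> 'a \<Rightarrow> real"
  assumes S: "open S" "q \<in> S"
    and partial: "\<And>b p. b \<in> Basis \<Longrightarrow> p \<in> S \<Longrightarrow> ((\<lambda>t. f (p + t *\<^sub>R b)) has_real_derivative D b p) (at 0)"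
    and cont: "\<And>b. b \<in> Basis \<Longrightarrow> continuous_on S (D b)"
  shows "(f has_derivative (\<lambda>h. \<Sum>b\<in>Basis. (h \<bullet> b) * D b q)) (at q)"
  unfolding has_derivative_at_alt
proof (intro conjI allI impI)
  show "bounded_linear (\<lambda>h. \<Sum>b\<in>Basis. (h \<bullet> b) * D b q)"
    by (intro bounded_linear_sum bounded_linear_mult_const bounded_linear_inner_left)
next
  fix e :: real
  assume "e > 0"
  define e' where "e' = e / DIM('a)"
  have e': "e' > 0"
    using \<open>e > 0\<close> by (simp add: e'_def)
  have "\<forall>\<^sub>F p in nhds q. \<forall>b\<in>Basis. p \<in> S \<and> \<bar>D b p - D b q\<bar> < e'"
  proof (intro eventually_ball_finite ballI eventually_conj)
    fix b :: 'a
    assume b: "b \<in> Basis"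
    show "\<forall>\<^sub>F p in nhds q. p \<in> S"
      using S by (rule eventually_nhds_in_open)
    have "isCont (D b) q"
      using cont[OF b] S by (simp add: continuous_on_eq_continuous_at)
    hence "(D b \<longlongrightarrow> D b q) (nhds q)"
      by (simp add: isCont_def tendsto_at_iff_tendsto_nhds)
    from tendstoD[OF this e'] show "\<forall>\<^sub>F p in nhds q. \<bar>D b p - D b q\<bar> < e'"
      by (simp add: dist_real_def)
  qed simp
  then obtain d where d: "d > 0"
    and close: "\<And>p b. dist p q < d \<Longrightarrow> b \<in> Basis \<Longrightarrow> p \<in> S \<and> \<bar>D b p - D b q\<bar> < e'"
    unfolding eventually_nhds_metric by blast
  have "norm (f y - f q - (\<Sum>b\<in>Basis. ((y - q) \<bullet> b) * D b q)) \<le> e * norm (y - q)"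
    if y: "norm (y - q) < d" for y
  proof -
    define h where "h = y - q"
    have *: "\<bar>f (q + (\<Sum>b\<in>B. (h \<bullet> b) *\<^sub>R b)) - f q - (\<Sum>b\<in>B. (h \<bullet> b) * D b q)\<bar>
        \<le> card B * (e' * norm h)" if "finite B" "B \<subseteq> Basis" for B
      using that
    proof (induction B rule: finite_induct)
      case (insert b B)
      hence b: "b \<in> Basis" and B: "B \<subseteq> Basis" by auto
      define p where "p = q + (\<Sum>b\<in>B. (h \<bullet> b) *\<^sub>R b)"
      \<comment> \<open>Each partial point has coordinates bounded by those of \<open>h\<close>, so it stays in the ball.\<close>
      have near: "dist (p + t *\<^sub>R b) q < d" if t: "\<bar>t\<bar> \<le> \<bar>h \<bullet> b\<bar>" for t
      proof -
        have "norm ((\<Sum>b\<in>B. (h \<bullet> b) *\<^sub>R b) + t *\<^sub>R b) \<le> norm h"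
        proof (rule norm_le_componentwise)
          fix c :: 'a assume c: "c \<in> Basis"
          have "(\<Sum>b\<in>B. (h \<bullet> b) *\<^sub>R b) \<bullet> c = (\<Sum>b\<in>B. if b = c then h \<bullet> c else 0)"
            unfolding inner_sum_left using B c
            by (intro sum.cong) (auto simp: inner_Basis)
          also have "\<dots> = (if c \<in> B then h \<bullet> c else 0)"
            using insert.hyps by simp
          finally have "(\<Sum>b\<in>B. (h \<bullet> b) *\<^sub>R b) \<bullet> c = (if c \<in> B then h \<bullet> c else 0)" .
          thus "\<bar>((\<Sum>b\<in>B. (h \<bullet> b) *\<^sub>R b) + t *\<^sub>R b) \<bullet> c\<bar> \<le> \<bar>h \<bullet> c\<bar>"
            using t insert.hyps b c by (auto simp: inner_add_left inner_Basis)
        qed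
        thus ?thesis
          using y by (simp add: p_def dist_norm h_def algebra_simps)
      qed
      let ?I = "closed_segment 0 (h \<bullet> b)"
      have I: "\<bar>t\<bar> \<le> \<bar>h \<bullet> b\<bar>" if "t \<in> ?I" for t
        using that by (auto simp: closed_segment_eq_real_ivl split: if_splits)
      have "norm ((f (p + (h \<bullet> b) *\<^sub>R b) - (h \<bullet> b) * D b q) - (f (p + 0 *\<^sub>R b) - 0 * D b q))
          \<le> e' * norm (h \<bullet> b - 0)"
      proof (rule field_differentiable_bound[where S = ?I
            and f' = "\<lambda>t. D b (p + t *\<^sub>R b) - D b q"])
        fix t assume t: "t \<in> ?I"
        note cl = close[OF near[OF I[OF t]] b]
        have "((\<lambda>s. f ((p + t *\<^sub>R b) + s *\<^sub>R b)) has_real_derivative D b (p + t *\<^sub>R b)) (at 0)"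
          using partial[OF b] cl by blast
        hence "((\<lambda>s. f (p + (s + t) *\<^sub>R b)) has_real_derivative D b (p + t *\<^sub>R b)) (at 0)"
          by (simp add: algebra_simps)
        hence "((\<lambda>s. f (p + s *\<^sub>R b)) has_real_derivative D b (p + t *\<^sub>R b)) (at t)"
          using DERIV_shift[of "\<lambda>s. f (p + s *\<^sub>R b)" "D b (p + t *\<^sub>R b)" 0 t] by simp
        hence "((\<lambda>s. f (p + s *\<^sub>R b) - s * D b q) has_real_derivative
            D b (p + t *\<^sub>R b) - D b q) (at t)"
          by (auto intro!: derivative_eq_intros)
        thus "((\<lambda>s. f (p + s *\<^sub>R b) - s * D b q) has_real_derivative
            D b (p + t *\<^sub>R b) - D b q) (at t within ?I)"
          by (rule has_field_derivative_at_within)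
        show "norm (D b (p + t *\<^sub>R b) - D b q) \<le> e'"
          using cl by simp
      qed auto
      also have "\<dots> \<le> e' * norm h"
        using e' Basis_le_norm[OF b] by simp
      finally have step: "\<bar>f (p + (h \<bullet> b) *\<^sub>R b) - f p - (h \<bullet> b) * D b q\<bar> \<le> e' * norm h"
        by (simp add: algebra_simps)
      have "f (q + (\<Sum>b\<in>insert b B. (h \<bullet> b) *\<^sub>R b)) = f (p + (h \<bullet> b) *\<^sub>R b)"
        using insert.hyps by (simp add: p_def algebra_simps)
      with step insert.IH[OF B] insert.hyps show ?case
        by (simp add: p_def[symmetric] algebra_simps)
    qed simp
    from *[of Basis] show ?thesis
      by (simp add: euclidean_representation h_def e'_def)
  qed
  with d show "\<exists>d>0. \<forall>y. norm (y - q) < d \<longrightarrow>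
      norm (f y - f q - (\<Sum>b\<in>Basis. ((y - q) \<bullet> b) * D b q)) \<le> e * norm (y - q)"
    by blast
qed

lemma has_real_derivative_along_line:
  fixes f :: "'a::euclidean_space \<Rightarrow> real" and D :: "'a \<Rightarrow> 'a \<Rightarrow> real"
  assumes "open S" "q + t *\<^sub>R v \<in> S"
    and "\<And>b p. b \<in> Basis \<Longrightarrow> p \<in> S \<Longrightarrow> ((\<lambda>t. f (p + t *\<^sub>R b)) has_real_derivative D b p) (at 0)"
    and "\<And>b. b \<in> Basis \<Longrightarrow> continuous_on S (D b)"
  shows "((\<lambda>t. f (q + t *\<^sub>R v)) has_real_derivative
    (\<Sum>b\<in>Basis. (v \<bullet> b) * D b (q + t *\<^sub>R v))) (at t)"
proof -
  have line: "((\<lambda>t. q + t *\<^sub>R v) has_vector_derivative v) (at t)"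
    by (auto intro!: derivative_eq_intros)
  have "(f has_derivative (\<lambda>h. \<Sum>b\<in>Basis. (h \<bullet> b) * D b (q + t *\<^sub>R v))) (at (q + t *\<^sub>R v))"
    using assms by (rule continuous_partials_imp_has_derivative)
  from has_derivative_compose[OF line[unfolded has_vector_derivative_def] this] show ?thesis
    unfolding has_field_derivative_def
    by (rule has_derivative_eq_rhs) (simp add: fun_eq_iff sum_distrib_left sum_distrib_right mult_ac)
qed

section \<open>Second-order characterisation of strong convexity\<close>

text \<open>For the forward direction, adding the tangent inequalities at two points shows that the
  derivative is monotone.\<close>

lemma convex_on_iff_second_derivative_nonneg:
  fixes \<phi> :: "real \<Rightarrow> real"
  assumes T: "open T" "convex T"
    and D1: "\<And>t. t \<in> T \<Longrightarrow> (\<phi> has_real_derivative \<phi>' t) (at t)"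
    and D2: "\<And>t. t \<in> T \<Longrightarrow> (\<phi>' has_real_derivative \<phi>'' t) (at t)"
  shows "convex_on T \<phi> \<longleftrightarrow> (\<forall>t\<in>T. \<phi>'' t \<ge> 0)"
proof
  assume cvx: "convex_on T \<phi>"
  have tangent: "\<phi>' s * (t - s) \<le> \<phi> t - \<phi> s" if "s \<in> T" "t \<in> T" for s t
  proof (rule convex_on_imp_above_tangent[OF cvx])
    show "connected T" using T by (simp add: convex_connected)
    show "s \<in> interior T" "t \<in> T" using T that by (simp_all add: interior_open)
    show "(\<phi> has_real_derivative \<phi>' s) (at s within T)"
      using D1 that by (simp add: has_field_derivative_at_within)
  qed
  have "mono_on T \<phi>'"
  proof (rule mono_onI)
    fix s t assume st: "s \<in> T" "t \<in> T" "s \<le> t"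
    have "(\<phi>' t - \<phi>' s) * (t - s) \<ge> 0"
      using tangent[of s t] tangent[of t s] st by (simp add: algebra_simps)
    thus "\<phi>' s \<le> \<phi>' t"
      using st by (cases "s = t") (auto simp: zero_le_mult_iff)
  qed
  thus "\<forall>t\<in>T. \<phi>'' t \<ge> 0"
    using mono_on_imp_deriv_nonneg[of T \<phi>'] D2 T by (simp add: interior_open) blast
next
  assume "\<forall>t\<in>T. \<phi>'' t \<ge> 0"
  thus "convex_on T \<phi>"
    using T D1 D2 by (intro f''_ge0_imp_convex[of T \<phi> \<phi>' \<phi>'']) auto
qed

text \<open>In an inner product space the defect of \<open>(norm x)\<^sup>2\<close> from being affine between two points
  \<open>p\<close> and \<open>q\<close> is exactly \<open>\<theta> (1 - \<theta>) (norm (p - q))\<^sup>2\<close>.\<close>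

lemma strongly_convex_on_iff_convex_on:
  fixes S :: "'a::real_inner set"
  assumes "convex S"
  shows "strongly_convex_on \<sigma> S f \<longleftrightarrow> convex_on S (\<lambda>x. f x - \<sigma> / 2 * (norm x)\<^sup>2)"
    (is "_ \<longleftrightarrow> convex_on S ?g")
proof -
  have *: "?g (\<theta> *\<^sub>R p + (1 - \<theta>) *\<^sub>R q) \<le> \<theta> * ?g p + (1 - \<theta>) * ?g q \<longleftrightarrow>
     f (\<theta> *\<^sub>R p + (1 - \<theta>) *\<^sub>R q)
       \<le> \<theta> * f p + (1 - \<theta>) * f q - \<sigma> / 2 * \<theta> * (1 - \<theta>) * (norm (p - q))\<^sup>2" for \<theta> p q
  proof -
    have "(norm (\<theta> *\<^sub>R p + (1 - \<theta>) *\<^sub>R q))\<^sup>2 =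
      \<theta> * (norm p)\<^sup>2 + (1 - \<theta>) * (norm q)\<^sup>2 - \<theta> * (1 - \<theta>) * (norm (p - q))\<^sup>2"
      unfolding power2_norm_eq_inner
      by (simp add: inner_simps inner_commute[of q p] algebra_simps power2_eq_square)
    moreover have "\<sigma> / 2 * X = \<theta> * (\<sigma> / 2 * a) + (1 - \<theta>) * (\<sigma> / 2 * b) - \<sigma> / 2 * \<theta> * (1 - \<theta>) * c"
      if "X = \<theta> * a + (1 - \<theta>) * b - \<theta> * (1 - \<theta>) * c" for X a b c :: real
      unfolding that by (simp add: algebra_simps add_divide_distrib diff_divide_distrib)
    ultimately have "\<sigma> / 2 * (norm (\<theta> *\<^sub>R p + (1 - \<theta>) *\<^sub>R q))\<^sup>2 =
      \<theta> * (\<sigma> / 2 * (norm p)\<^sup>2) + (1 - \<theta>) * (\<sigma> / 2 * (norm q)\<^sup>2)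
        - \<sigma> / 2 * \<theta> * (1 - \<theta>) * (norm (p - q))\<^sup>2"
      by blast
    thus ?thesis by (simp only: right_diff_distrib) linarith
  qed
  have "convex_on S ?g \<longleftrightarrow> (\<forall>p\<in>S. \<forall>q\<in>S. \<forall>\<theta>\<in>{0<..<1}.
      ?g (\<theta> *\<^sub>R p + (1 - \<theta>) *\<^sub>R q) \<le> \<theta> * ?g p + (1 - \<theta>) * ?g q)" (is "_ = ?R")
  proof
    assume "convex_on S ?g"
    thus ?R unfolding convex_on_def by auto
  next
    assume R: ?R
    show "convex_on S ?g"
      unfolding convex_on_def
    proof (intro conjI assms ballI allI impI)
      fix x y and u v :: real
      assume xy: "x \<in> S" "y \<in> S" and uv: "0 \<le> u" "0 \<le> v" "u + v = 1"
      have v: "v = 1 - u" using uv by simp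
      consider "u = 0" | "u = 1" | "u \<in> {0<..<1}" using uv by force
      thus "?g (u *\<^sub>R x + v *\<^sub>R y) \<le> u * ?g x + v * ?g y"
      proof cases
        case 3
        thus ?thesis unfolding v using R xy by blast
      qed (simp_all add: v)
    qed
  qed
  thus ?thesis
    unfolding strongly_convex_on_def * by simp
qed

lemma open_line_preimage:
  fixes S :: "'a::real_normed_vector set"
  assumes "open S"
  shows "open {t::real. q + t *\<^sub>R v \<in> S}"
  using open_vimage[OF assms, of "\<lambda>t. q + t *\<^sub>R v"]
  by (simp add: vimage_def continuous_intros)

lemma convex_line_preimage:
  fixes S :: "'a::real_vector set"
  assumes "convex S"
  shows "convex {t::real. q + t *\<^sub>R v \<in> S}"
proof (rule convexI)
  fix s t u w :: real
  assume st: "s \<in> {t. q + t *\<^sub>R v \<in> S}" "t \<in> {t. q + t *\<^sub>R v \<in> S}"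
    and uw: "0 \<le> u" "0 \<le> w" "u + w = 1"
  have "u *\<^sub>R (q + s *\<^sub>R v) + w *\<^sub>R (q + t *\<^sub>R v) = (u + w) *\<^sub>R q + (u * s + w * t) *\<^sub>R v"
    by (simp add: algebra_simps)
  moreover have "u *\<^sub>R (q + s *\<^sub>R v) + w *\<^sub>R (q + t *\<^sub>R v) \<in> S"
    using convexD[OF assms] st uw by simp
  ultimately show "u *\<^sub>R s + w *\<^sub>R t \<in> {t. q + t *\<^sub>R v \<in> S}"
    using uw by simp
qed

lemma convex_on_iff_convex_on_lines:
  fixes S :: "'a::real_vector set"
  assumes "convex S"
  shows "convex_on S g \<longleftrightarrow> (\<forall>q v. convex_on {t::real. q + t *\<^sub>R v \<in> S} (\<lambda>t. g (q + t *\<^sub>R v)))"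
    (is "_ \<longleftrightarrow> ?R")
proof
  assume g: "convex_on S g"
  show ?R
    unfolding convex_on_def
  proof (intro allI conjI ballI impI convex_line_preimage assms)
    fix q v and s t u w :: real
    assume st: "s \<in> {t. q + t *\<^sub>R v \<in> S}" "t \<in> {t. q + t *\<^sub>R v \<in> S}"
      and uw: "0 \<le> u" "0 \<le> w" "u + w = 1"
    have "u *\<^sub>R (q + s *\<^sub>R v) + w *\<^sub>R (q + t *\<^sub>R v) = (u + w) *\<^sub>R q + (u * s + w * t) *\<^sub>R v"
      by (simp add: algebra_simps)
    moreover have "g (u *\<^sub>R (q + s *\<^sub>R v) + w *\<^sub>R (q + t *\<^sub>R v))
        \<le> u * g (q + s *\<^sub>R v) + w * g (q + t *\<^sub>R v)"
      using g st uw unfolding convex_on_def by simp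
    ultimately show "g (q + (u *\<^sub>R s + w *\<^sub>R t) *\<^sub>R v)
        \<le> u * g (q + s *\<^sub>R v) + w * g (q + t *\<^sub>R v)"
      using uw by simp
  qed
next
  assume R: ?R
  show "convex_on S g"
    unfolding convex_on_def
  proof (intro conjI assms ballI allI impI)
    fix x y and u v :: real
    assume xy: "x \<in> S" "y \<in> S" and uv: "0 \<le> u" "0 \<le> v" "u + v = 1"
    have v: "v = 1 - u" using uv by simp
    have "convex_on {t::real. y + t *\<^sub>R (x - y) \<in> S} (\<lambda>t. g (y + t *\<^sub>R (x - y)))"
      using R by blast
    from convex_onD[OF this, of u 0 1] have "g (y + u *\<^sub>R (x - y)) \<le> (1 - u) * g y + u * g x"
      using xy uv by simp
    moreover have "y + u *\<^sub>R (x - y) = u *\<^sub>R x + v *\<^sub>R y"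
      unfolding v by (simp add: algebra_simps)
    ultimately show "g (u *\<^sub>R x + v *\<^sub>R y) \<le> u * g x + v * g y"
      by (simp add: v)
  qed
qed

lemma strongly_convex_on_iff_second_partials:
  fixes f :: "'a::euclidean_space \<Rightarrow> real" and D :: "'a \<Rightarrow> 'a \<Rightarrow> real"
    and H :: "'a \<Rightarrow> 'a \<Rightarrow> 'a \<Rightarrow> real"
  assumes S: "open S" "convex S"
    and D: "\<And>b p. b \<in> Basis \<Longrightarrow> p \<in> S \<Longrightarrow> ((\<lambda>t. f (p + t *\<^sub>R b)) has_real_derivative D b p) (at 0)"
      "\<And>b. b \<in> Basis \<Longrightarrow> continuous_on S (D b)"
    and H: "\<And>b c p. b \<in> Basis \<Longrightarrow> c \<in> Basis \<Longrightarrow> p \<in> S \<Longrightarrow>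
        ((\<lambda>t. D b (p + t *\<^sub>R c)) has_real_derivative H b c p) (at 0)"
      "\<And>b c. b \<in> Basis \<Longrightarrow> c \<in> Basis \<Longrightarrow> continuous_on S (H b c)"
  shows "strongly_convex_on \<sigma> S f \<longleftrightarrow>
    (\<forall>q\<in>S. \<forall>v. \<sigma> * (norm v)\<^sup>2 \<le> (\<Sum>b\<in>Basis. \<Sum>c\<in>Basis. (v \<bullet> b) * (v \<bullet> c) * H b c q))"
proof -
  define Q where "Q q v = (\<Sum>b\<in>Basis. \<Sum>c\<in>Basis. (v \<bullet> b) * (v \<bullet> c) * H b c q)" for q v
  let ?g = "\<lambda>x. f x - \<sigma> / 2 * (norm x)\<^sup>2"
  have line: "convex_on {t. q + t *\<^sub>R v \<in> S} (\<lambda>t. ?g (q + t *\<^sub>R v)) \<longleftrightarrow>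
      (\<forall>t\<in>{t. q + t *\<^sub>R v \<in> S}. Q (q + t *\<^sub>R v) v - \<sigma> * (norm v)\<^sup>2 \<ge> 0)" for q v
  proof (rule convex_on_iff_second_derivative_nonneg
      [where \<phi>' = "\<lambda>t. (\<Sum>b\<in>Basis. (v \<bullet> b) * D b (q + t *\<^sub>R v)) - \<sigma> * (q \<bullet> v + t * (v \<bullet> v))"])
    fix t :: real
    assume "t \<in> {t. q + t *\<^sub>R v \<in> S}"
    hence t: "q + t *\<^sub>R v \<in> S" by simp
    have expand: "(\<lambda>t. ?g (q + t *\<^sub>R v)) =
        (\<lambda>t. f (q + t *\<^sub>R v) - \<sigma> / 2 * (q \<bullet> q + 2 * t * (q \<bullet> v) + t * t * (v \<bullet> v)))"
      unfolding power2_norm_eq_inner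
      by (simp add: inner_simps inner_commute[of v q] algebra_simps)
    show "((\<lambda>t. ?g (q + t *\<^sub>R v)) has_real_derivative
        (\<Sum>b\<in>Basis. (v \<bullet> b) * D b (q + t *\<^sub>R v)) - \<sigma> * (q \<bullet> v + t * (v \<bullet> v))) (at t)"
      unfolding expand
    proof (rule DERIV_diff)
      show "((\<lambda>t. f (q + t *\<^sub>R v)) has_real_derivative
          (\<Sum>b\<in>Basis. (v \<bullet> b) * D b (q + t *\<^sub>R v))) (at t)"
        using S(1) t D by (rule has_real_derivative_along_line)
      show "((\<lambda>t. \<sigma> / 2 * (q \<bullet> q + 2 * t * (q \<bullet> v) + t * t * (v \<bullet> v))) has_real_derivative
          \<sigma> * (q \<bullet> v + t * (v \<bullet> v))) (at t)"
        by (auto intro!: derivative_eq_intros simp: algebra_simps)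
    qed
    have "((\<lambda>t. D b (q + t *\<^sub>R v)) has_real_derivative
        (\<Sum>c\<in>Basis. (v \<bullet> c) * H b c (q + t *\<^sub>R v))) (at t)" if "b \<in> Basis" for b
      using S(1) t H(1)[OF that] H(2)[OF that] by (rule has_real_derivative_along_line)
    hence "((\<lambda>t. \<Sum>b\<in>Basis. (v \<bullet> b) * D b (q + t *\<^sub>R v)) has_real_derivative
        (\<Sum>b\<in>Basis. (v \<bullet> b) * (\<Sum>c\<in>Basis. (v \<bullet> c) * H b c (q + t *\<^sub>R v)))) (at t)"
      by (intro DERIV_sum DERIV_cmult)
    also have "(\<Sum>b\<in>Basis. (v \<bullet> b) * (\<Sum>c\<in>Basis. (v \<bullet> c) * H b c (q + t *\<^sub>R v))) = Q (q + t *\<^sub>R v) v"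
      by (simp add: Q_def sum_distrib_left mult.assoc)
    finally have linear: "((\<lambda>t. \<Sum>b\<in>Basis. (v \<bullet> b) * D b (q + t *\<^sub>R v)) has_real_derivative
        Q (q + t *\<^sub>R v) v) (at t)" .
    have quadratic: "((\<lambda>t. \<sigma> * (q \<bullet> v + t * (v \<bullet> v))) has_real_derivative \<sigma> * (norm v)\<^sup>2) (at t)"
      by (auto intro!: derivative_eq_intros simp: power2_norm_eq_inner)
    show "((\<lambda>t. (\<Sum>b\<in>Basis. (v \<bullet> b) * D b (q + t *\<^sub>R v)) - \<sigma> * (q \<bullet> v + t * (v \<bullet> v)))
        has_real_derivative Q (q + t *\<^sub>R v) v - \<sigma> * (norm v)\<^sup>2) (at t)"
      by (rule DERIV_diff[OF linear quadratic])
  qed (use S in \<open>simp_all add: open_line_preimage convex_line_preimage\<close>)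
  have "strongly_convex_on \<sigma> S f \<longleftrightarrow>
      (\<forall>q v. \<forall>t\<in>{t. q + t *\<^sub>R v \<in> S}. Q (q + t *\<^sub>R v) v - \<sigma> * (norm v)\<^sup>2 \<ge> 0)"
    unfolding strongly_convex_on_iff_convex_on[OF S(2)] convex_on_iff_convex_on_lines[OF S(2)] line ..
  also have "\<dots> \<longleftrightarrow> (\<forall>q\<in>S. \<forall>v. \<sigma> * (norm v)\<^sup>2 \<le> Q q v)"
  proof safe
    fix q v
    assume *: "\<forall>q v. \<forall>t\<in>{t. q + t *\<^sub>R v \<in> S}. 0 \<le> Q (q + t *\<^sub>R v) v - \<sigma> * (norm v)\<^sup>2" and "q \<in> S"
    have "0 \<in> {t. q + t *\<^sub>R v \<in> S}"
      using \<open>q \<in> S\<close> by simp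
    with * have "0 \<le> Q (q + 0 *\<^sub>R v) v - \<sigma> * (norm v)\<^sup>2" by blast
    thus "\<sigma> * (norm v)\<^sup>2 \<le> Q q v" by simp
  qed auto
  finally show ?thesis unfolding Q_def .
qed

section \<open>Quaternion space as a Euclidean space\<close>

lemma all_qidx: "(\<forall>u. P u) \<longleftrightarrow> P Idx_1 \<and> P Idx_i \<and> P Idx_j \<and> P Idx_k"
  by (metis qidx.exhaust)

lemma sum_qidx: "(\<Sum>u\<in>UNIV. g u) = g Idx_1 + g Idx_i + g Idx_j + g Idx_k"
  by (simp add: UNIV_qidx add.assoc)

instantiation quat :: euclidean_space
begin
definition "Basis = range qunit"
instance
proof
  show "(Basis :: quat set) \<noteq> {}" "finite (Basis :: quat set)"
    by (simp_all add: Basis_quat_def)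
  show "u \<bullet> v = (if u = v then 1 else 0)" if uv: "u \<in> Basis" "v \<in> Basis" for u v :: quat
  proof -
    obtain a b where "u = qunit a" "v = qunit b"
      using uv unfolding Basis_quat_def by blast
    thus ?thesis
      by (cases a; cases b) (simp_all add: quat_eq_iff inner_quat_def quat_i_def quat_j_def quat_k_def)
  qed
  show "(\<forall>u\<in>Basis. x \<bullet> u = 0) \<longleftrightarrow> x = 0" for x :: quat
    by (simp add: Basis_quat_def all_qidx quat_eq_iff inner_quat_def quat_i_def quat_j_def quat_k_def)
qed
end

lemma inj_qunit: "inj qunit"
proof (rule injI)
  fix u v assume "qunit u = qunit v"
  thus "u = v"
    by (cases u; cases v) (simp_all add: quat_eq_iff quat_i_def quat_j_def quat_k_def)
qed

lemma qunit_nonzero [simp]: "qunit u \<noteq> 0"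
  by (cases u) (simp_all add: quat_eq_iff quat_i_def quat_j_def quat_k_def)

abbreviation coord_dir :: "'n::finite \<Rightarrow> qidx \<Rightarrow> quat^'n" where
  "coord_dir l u \<equiv> axis l (qunit u)"

lemma Basis_quat_vec: "(Basis :: (quat^'n::finite) set) = range (\<lambda>(l, u). coord_dir l u)"
  unfolding Basis_vec_def Basis_quat_def by fast

lemma inj_coord_dir: "inj (\<lambda>(l::'n::finite, u). coord_dir l u)"
proof (rule injI, clarify)
  fix l m :: 'n and u v
  assume "coord_dir l u = coord_dir m v"
  thus "l = m \<and> u = v"
    unfolding axis_eq_axis using inj_qunit qunit_nonzero by (metis injD)
qed

lemma sum_Basis_quat_vec:
  "(\<Sum>b\<in>(Basis :: (quat^'n::finite) set). g b) = (\<Sum>l\<in>UNIV. \<Sum>u\<in>UNIV. g (coord_dir l u))"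
proof -
  have "(\<Sum>b\<in>(Basis :: (quat^'n) set). g b) = (\<Sum>(l, u)\<in>UNIV \<times> UNIV. g (coord_dir l u))"
    unfolding Basis_quat_vec by (subst sum.reindex[OF inj_coord_dir]) (simp add: comp_def case_prod_unfold)
  thus ?thesis
    unfolding sum.cartesian_product by simp
qed

lemma scaleR_coord_dir: "axis l (t *\<^sub>R qunit u) = t *\<^sub>R coord_dir l u"
  by (simp add: vec_eq_iff axis_def)


section \<open>Real partial derivatives in the domain\<close>

text \<open>A point near \<open>q\<close> is the average of points on the coordinate lines through \<open>q\<close>: with
  \<open>N\<close> directions, the displacement along each of them is stretched by the factor \<open>N\<close>.\<close>

lemma open_if_convex_and_coordinate_lines:
  fixes C :: "'a::euclidean_space set"
  assumes C: "convex C"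
    and lines: "\<And>q b. q \<in> C \<Longrightarrow> b \<in> Basis \<Longrightarrow> \<forall>\<^sub>F t in at (0::real). q + t *\<^sub>R b \<in> C"
  shows "open C"
  unfolding open_dist
proof
  fix q assume q: "q \<in> C"
  have "\<forall>\<^sub>F t in nhds (0::real). \<forall>b\<in>Basis. q + t *\<^sub>R b \<in> C"
  proof (intro eventually_ball_finite ballI)
    fix b :: 'a assume "b \<in> Basis"
    from lines[OF q this] have "\<forall>\<^sub>F t in nhds 0. t \<noteq> 0 \<longrightarrow> q + t *\<^sub>R b \<in> C"
      by (simp add: eventually_at_filter)
    thus "\<forall>\<^sub>F t in nhds 0. q + t *\<^sub>R b \<in> C"
      by (rule eventually_mono) (use q in auto)
  qed simp
  then obtain d where d: "d > 0"
    and near: "\<And>t b. \<bar>t\<bar> < d \<Longrightarrow> b \<in> Basis \<Longrightarrow> q + t *\<^sub>R b \<in> C"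
    unfolding eventually_nhds_metric by (auto simp: dist_real_def)
  define N where "N = real DIM('a)"
  have N: "N > 0" by (simp add: N_def)
  have "y \<in> C" if y: "dist y q < d / N" for y
  proof -
    have "(\<Sum>b\<in>Basis. (1 / N) *\<^sub>R (q + (N * ((y - q) \<bullet> b)) *\<^sub>R b)) \<in> C"
    proof (rule convex_sum[OF _ C])
      show "(\<Sum>b\<in>(Basis :: 'a set). 1 / N) = 1" by (simp add: N_def)
      fix b :: 'a assume b: "b \<in> Basis"
      have "\<bar>(y - q) \<bullet> b\<bar> < d / N"
        using Basis_le_norm[OF b, of "y - q"] y by (simp add: dist_norm)
      hence "\<bar>N * ((y - q) \<bullet> b)\<bar> < d"
        using N by (simp add: abs_mult field_simps)
      thus "q + (N * ((y - q) \<bullet> b)) *\<^sub>R b \<in> C"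
        using near b by blast
    qed (use N in auto)
    also have "(\<Sum>b\<in>Basis. (1 / N) *\<^sub>R (q + (N * ((y - q) \<bullet> b)) *\<^sub>R b)) =
        (\<Sum>b\<in>(Basis :: 'a set). (1 / N) *\<^sub>R q) + (\<Sum>b\<in>Basis. ((y - q) \<bullet> b) *\<^sub>R b)"
      using N by (simp add: scaleR_add_right sum.distrib)
    also have "\<dots> = y"
      unfolding euclidean_representation by (simp add: N_def sum_constant_scaleR)
    finally show ?thesis .
  qed
  thus "\<exists>e>0. \<forall>y. dist y q < e \<longrightarrow> y \<in> C"
    using d N by (intro exI[of _ "d / N"]) auto
qed

text \<open>Indexing partial derivatives by basis vectors instead of pairs \<open>(l, u)\<close> makes the results for
  general Euclidean spaces applicable.\<close>

definition dir_deriv :: "('a::real_normed_vector \<Rightarrow> 'b::real_normed_vector) \<Rightarrow> 'a \<Rightarrow> 'a \<Rightarrow> 'b" where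
  "dir_deriv g v p = vector_derivative (\<lambda>t. g (p + t *\<^sub>R v)) (at 0)"

lemma real_partial_eq_dir_deriv: "real_partial g l u = dir_deriv g (coord_dir l u)"
  by (simp add: fun_eq_iff real_partial_def dir_deriv_def scaleR_coord_dir)

lemma real_partial_eqI:
  "((\<lambda>t. g (q + t *\<^sub>R coord_dir l u)) has_vector_derivative D) (at 0) \<Longrightarrow> real_partial g l u q = D"
  by (simp add: real_partial_def scaleR_coord_dir vector_derivative_at)

lemma real_C1_on_has_vector_derivative:
  assumes "real_C1_on C g" "q \<in> C"
  shows "((\<lambda>t. g (q + t *\<^sub>R coord_dir l u)) has_vector_derivative real_partial g l u q) (at 0)"
  using assms unfolding real_C1_on_def has_real_partial_in_def
  by (simp add: real_partial_def scaleR_coord_dir vector_derivative_works)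

lemma real_C1_on_open:
  fixes C :: "(quat^'n::finite) set"
  assumes "convex C" "real_C1_on C g"
  shows "open C"
proof (rule open_if_convex_and_coordinate_lines[OF assms(1)])
  fix q :: "quat^'n" and b :: "quat^'n"
  assume "q \<in> C" "b \<in> Basis"
  thus "\<forall>\<^sub>F t in at (0::real). q + t *\<^sub>R b \<in> C"
    using assms(2) unfolding Basis_quat_vec real_C1_on_def has_real_partial_in_def
    by (auto simp: scaleR_coord_dir)
qed

lemma strongly_convex_on_iff_real_partials:
  fixes C :: "(quat^'n::finite) set" and f :: "quat^'n \<Rightarrow> real"
  assumes C: "convex C" and f: "real_C2_on C f"
  shows "strongly_convex_on \<sigma> C f \<longleftrightarrow>
    (\<forall>q\<in>C. \<forall>v. \<sigma> * (norm v)\<^sup>2 \<le> (\<Sum>m\<in>UNIV. \<Sum>a\<in>UNIV. \<Sum>l\<in>UNIV. \<Sum>b\<in>UNIV.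
      (v \<bullet> coord_dir m a) * (v \<bullet> coord_dir l b) * real_partial (real_partial f m a) l b q))"
proof -
  have f1: "real_C1_on C f" and f2: "\<And>m a. real_C1_on C (real_partial f m a)"
    using f by (auto simp: real_C2_on_def)
  have coord: "\<exists>l u. b = coord_dir l u" if "b \<in> Basis" for b :: "quat^'n"
    using that by (auto simp: Basis_quat_vec)
  have "strongly_convex_on \<sigma> C f \<longleftrightarrow>
    (\<forall>q\<in>C. \<forall>v. \<sigma> * (norm v)\<^sup>2 \<le>
      (\<Sum>b\<in>Basis. \<Sum>c\<in>Basis. (v \<bullet> b) * (v \<bullet> c) * dir_deriv (dir_deriv f b) c q))"
  proof (rule strongly_convex_on_iff_second_partials[OF real_C1_on_open[OF C f1] C])
    fix b p :: "quat^'n" assume "b \<in> Basis"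
    then obtain l u where b: "b = coord_dir l u" using coord by blast
    show "continuous_on C (dir_deriv f b)"
      using f1 by (simp add: real_C1_on_def b flip: real_partial_eq_dir_deriv)
    assume p: "p \<in> C"
    show "((\<lambda>t. f (p + t *\<^sub>R b)) has_real_derivative dir_deriv f b p) (at 0)"
      using real_C1_on_has_vector_derivative[OF f1 p]
      by (simp add: b has_real_derivative_iff_has_vector_derivative flip: real_partial_eq_dir_deriv)
  next
    fix b c p :: "quat^'n" assume "b \<in> Basis" "c \<in> Basis"
    then obtain l u m a where bc: "b = coord_dir m a" "c = coord_dir l u" using coord by meson
    show "continuous_on C (dir_deriv (dir_deriv f b) c)"
      using f2 by (simp add: real_C1_on_def bc flip: real_partial_eq_dir_deriv)
    assume p: "p \<in> C"
    show "((\<lambda>t. dir_deriv f b (p + t *\<^sub>R c)) has_real_derivative dir_deriv (dir_deriv f b) c p) (at 0)"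
      using real_C1_on_has_vector_derivative[OF f2 p]
      by (simp add: bc has_real_derivative_iff_has_vector_derivative flip: real_partial_eq_dir_deriv)
  qed
  thus ?thesis
    by (simp only: sum_Basis_quat_vec real_partial_eq_dir_deriv)
qed

section \<open>The augmented Hessian in real coordinates\<close>

abbreviation unit_rot :: "qidx \<Rightarrow> qidx \<Rightarrow> quat" where
  "unit_rot \<mu> a \<equiv> qrot (qunit \<mu>) (qunit a)"

lemmas quat_unit_simps = quat_eq_iff quat_i_def quat_j_def quat_k_def

lemma unit_rot_eq:
  "unit_rot \<mu> a = (if \<mu> = Idx_1 \<or> a = Idx_1 \<or> \<mu> = a then qunit a else - qunit a)"
  by (cases \<mu>; cases a)
     (simp_all add: quat_unit_simps qrot_def inverse_quat_def norm_quat_def)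

lemma ghr_conj_eq_sum:
  "ghr_conj g m (qunit \<mu>) q = (1/4) *\<^sub>R (\<Sum>a\<in>UNIV. real_partial g m a q * unit_rot \<mu> a)"
  using unit_rot_eq[of \<mu> Idx_1] by (simp add: ghr_conj_def sum_qidx)

lemma ghr_eq_sum:
  "ghr g l (qunit \<nu>) q = (1/4) *\<^sub>R (\<Sum>b\<in>UNIV. real_partial g l b q * qcnj (unit_rot \<nu> b))"
proof -
  have "qcnj (unit_rot \<nu> b) = (if b = Idx_1 then 1 else - unit_rot \<nu> b)" for b
    unfolding unit_rot_eq by (cases \<nu>; cases b) (simp_all add: quat_unit_simps)
  thus ?thesis by (simp add: ghr_def sum_qidx)
qed

text \<open>The outer derivative only sees the inner one near \<open>q\<close>, where it has the explicit form below
  because \<open>C\<close> is open.\<close>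

lemma aug_hessian_entry:
  fixes C :: "(quat^'n::finite) set" and f :: "quat^'n \<Rightarrow> real"
  assumes C: "convex C" and f: "real_C2_on C f" and q: "q \<in> C"
  shows "aug_hessian f q $ (\<mu>, m) $ (\<nu>, l) = (1/16) *\<^sub>R (\<Sum>a\<in>UNIV. \<Sum>b\<in>UNIV.
    real_partial (real_partial f m a) l b q *\<^sub>R (unit_rot \<mu> a * qcnj (unit_rot \<nu> b)))"
proof -
  have f1: "real_C1_on C f" and f2: "\<And>m a. real_C1_on C (real_partial f m a)"
    using f by (auto simp: real_C2_on_def)
  let ?f = "\<lambda>p. of_real (f p) :: quat"
  let ?G = "\<lambda>p. (1/4) *\<^sub>R (\<Sum>a\<in>UNIV. real_partial f m a p *\<^sub>R unit_rot \<mu> a)"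
  have inner: "ghr_conj ?f m (qunit \<mu>) p = ?G p" if p: "p \<in> C" for p
  proof -
    have "real_partial ?f m a p = of_real (real_partial f m a p)" for a
      by (intro real_partial_eqI bounded_linear.has_vector_derivative[OF bounded_linear_of_real]
          real_C1_on_has_vector_derivative[OF f1 p])
    thus ?thesis
      by (simp add: ghr_conj_eq_sum scaleR_conv_of_real)
  qed
  have outer: "real_partial (ghr_conj ?f m (qunit \<mu>)) l b q =
      (1/4) *\<^sub>R (\<Sum>a\<in>UNIV. real_partial (real_partial f m a) l b q *\<^sub>R unit_rot \<mu> a)" for b
  proof (rule real_partial_eqI)
    let ?T = "{t::real. q + t *\<^sub>R coord_dir l b \<in> C}"
    have "open ?T"
      using real_C1_on_open[OF C f1] by (rule open_line_preimage)
    moreover have "0 \<in> ?T"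
      using q by simp
    moreover have "((\<lambda>t. ?G (q + t *\<^sub>R coord_dir l b)) has_vector_derivative
        (1/4) *\<^sub>R (\<Sum>a\<in>UNIV. real_partial (real_partial f m a) l b q *\<^sub>R unit_rot \<mu> a)) (at 0)"
      by (intro bounded_linear.has_vector_derivative[OF bounded_linear_scaleR_right]
          has_vector_derivative_sum bounded_linear.has_vector_derivative[OF bounded_linear_scaleR_left]
          real_C1_on_has_vector_derivative[OF f2 q])
    ultimately show "((\<lambda>t. ghr_conj ?f m (qunit \<mu>) (q + t *\<^sub>R coord_dir l b)) has_vector_derivative
        (1/4) *\<^sub>R (\<Sum>a\<in>UNIV. real_partial (real_partial f m a) l b q *\<^sub>R unit_rot \<mu> a)) (at 0)"
      by (elim has_vector_derivative_transform_within_open[rotated 2, rotated -1])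
         (simp_all add: inner)
  qed
  have "aug_hessian f q $ (\<mu>, m) $ (\<nu>, l) = ghr (ghr_conj ?f m (qunit \<mu>)) l (qunit \<nu>) q"
    by (simp add: aug_hessian_def quat_hessian_def)
  also have "\<dots> = (1/16) *\<^sub>R (\<Sum>b\<in>UNIV. \<Sum>a\<in>UNIV.
      real_partial (real_partial f m a) l b q *\<^sub>R (unit_rot \<mu> a * qcnj (unit_rot \<nu> b)))"
    unfolding ghr_eq_sum outer by (simp add: scaleR_sum_right sum_distrib_right)
  also have "\<dots> = (1/16) *\<^sub>R (\<Sum>a\<in>UNIV. \<Sum>b\<in>UNIV.
      real_partial (real_partial f m a) l b q *\<^sub>R (unit_rot \<mu> a * qcnj (unit_rot \<nu> b)))"
    by (subst sum.swap) simp
  finally show ?thesis .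
qed

text \<open>This is \<open>J\<^sup>H x\<close> for the matrix \<open>J\<close> that maps the real components \<open>(q\<^sub>a, q\<^sub>b, q\<^sub>c, q\<^sub>d)\<close> of a
  vector to its augmented vector \<open>(q, q\<^sup>i, q\<^sup>j, q\<^sup>k)\<close>. It satisfies \<open>J J\<^sup>H = J\<^sup>H J = 4 I\<close>.\<close>

definition unmix :: "quat^(qidx \<times> 'n::finite) \<Rightarrow> 'n \<Rightarrow> qidx \<Rightarrow> quat" where
  "unmix x m a = (\<Sum>\<mu>\<in>UNIV. qcnj (unit_rot \<mu> a) * x $ (\<mu>, m))"

lemma qcnj_sum: "qcnj (sum g A) = (\<Sum>i\<in>A. qcnj (g i))"
  by (induction A rule: infinite_finite_induct) (simp_all add: quat_eq_iff)

lemma qcnj_mult: "qcnj (p * q) = qcnj q * qcnj p"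
  by (simp add: quat_eq_iff)

lemma qcnj_qcnj [simp]: "qcnj (qcnj q) = q"
  by (simp add: quat_eq_iff)

lemma qa_sum: "qa (sum g A) = (\<Sum>i\<in>A. qa (g i))"
  by (induction A rule: infinite_finite_induct) simp_all

lemma qa_qcnj_mult: "qa (qcnj p * q) = p \<bullet> q"
  by (simp add: inner_quat_def)

lemma sum_UNIV_block: "(\<Sum>r\<in>UNIV. g r) = (\<Sum>\<mu>\<in>UNIV. \<Sum>m\<in>UNIV. g (\<mu>, m))"
  unfolding UNIV_Times_UNIV[symmetric] sum.cartesian_product by simp

text \<open>Each entry of the Hessian factors through the pair of units \<open>(a, b)\<close>, so the sums over the
  block indices can be performed first, one on each side.\<close>

lemma aug_hessian_quadratic_form:
  fixes C :: "(quat^'n::finite) set" and f :: "quat^'n \<Rightarrow> real"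
  assumes "convex C" "real_C2_on C f" "q \<in> C"
  shows "qa (hdot x (aug_hessian f q *v x)) = (1/16) * (\<Sum>m\<in>UNIV. \<Sum>a\<in>UNIV. \<Sum>l\<in>UNIV. \<Sum>b\<in>UNIV.
    real_partial (real_partial f m a) l b q * (unmix x m a \<bullet> unmix x l b))"
proof -
  let ?R = "\<lambda>m a l b. real_partial (real_partial f m a) l b q"
  let ?t = "\<lambda>m a l b \<mu> \<nu>. ?R m a l b *\<^sub>R
    (qcnj (x $ (\<mu>, m)) * unit_rot \<mu> a * (qcnj (unit_rot \<nu> b) * x $ (\<nu>, l)))"
  have "hdot x (aug_hessian f q *v x) = (1/16) *\<^sub>R (\<Sum>\<mu>\<in>UNIV. \<Sum>m\<in>UNIV. \<Sum>\<nu>\<in>UNIV. \<Sum>l\<in>UNIV.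
      \<Sum>a\<in>UNIV. \<Sum>b\<in>UNIV. ?t m a l b \<mu> \<nu>)"
    by (simp add: hdot_def matrix_vector_mult_def sum_UNIV_block aug_hessian_entry[OF assms]
        scaleR_sum_right sum_distrib_left sum_distrib_right mult.assoc)
  also have "(\<Sum>\<mu>\<in>UNIV. \<Sum>m\<in>UNIV. \<Sum>\<nu>\<in>UNIV. \<Sum>l\<in>UNIV. \<Sum>a\<in>UNIV. \<Sum>b\<in>UNIV. ?t m a l b \<mu> \<nu>) =
      (\<Sum>(\<mu>, m, \<nu>, l, a, b)\<in>UNIV. ?t m a l b \<mu> \<nu>)"
    by (simp add: sum.cartesian_product)
  also have "\<dots> = (\<Sum>(m, a, l, b, \<mu>, \<nu>)\<in>UNIV. ?t m a l b \<mu> \<nu>)"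
    by (rule sum.reindex_bij_witness[of _ "\<lambda>(m, a, l, b, \<mu>, \<nu>). (\<mu>, m, \<nu>, l, a, b)"
        "\<lambda>(\<mu>, m, \<nu>, l, a, b). (m, a, l, b, \<mu>, \<nu>)"]) auto
  also have "\<dots> = (\<Sum>m\<in>UNIV. \<Sum>a\<in>UNIV. \<Sum>l\<in>UNIV. \<Sum>b\<in>UNIV. \<Sum>\<mu>\<in>UNIV. \<Sum>\<nu>\<in>UNIV. ?t m a l b \<mu> \<nu>)"
    by (simp add: sum.cartesian_product)
  also have "\<dots> = (\<Sum>m\<in>UNIV. \<Sum>a\<in>UNIV. \<Sum>l\<in>UNIV. \<Sum>b\<in>UNIV.
      ?R m a l b *\<^sub>R (qcnj (unmix x m a) * unmix x l b))"
    by (simp add: unmix_def qcnj_sum qcnj_mult sum_product scaleR_sum_right)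
  finally show ?thesis
    by (simp add: qa_sum qa_qcnj_mult del: quat_mult_sel(5))
qed

text \<open>The orthogonality \<open>J J\<^sup>H = 4 I\<close>, position by position.\<close>

lemma sum_norm_unmix: "(\<Sum>m\<in>UNIV. \<Sum>a\<in>UNIV. (norm (unmix x m a))\<^sup>2) = 4 * (norm x)\<^sup>2"
proof -
  have "(\<Sum>a\<in>UNIV. (norm (unmix x m a))\<^sup>2) = 4 * (\<Sum>\<mu>\<in>UNIV. (norm (x $ (\<mu>, m)))\<^sup>2)" for m
    unfolding unmix_def sum_qidx unit_rot_eq
    by (simp add: quat_unit_simps norm_quat_def) (simp add: power2_eq_square algebra_simps)
  moreover have "(norm x)\<^sup>2 = (\<Sum>m\<in>UNIV. \<Sum>\<mu>\<in>UNIV. (norm (x $ (\<mu>, m)))\<^sup>2)"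
    unfolding norm_vec_def L2_set_def
    by (subst real_sqrt_pow2) (simp_all add: sum_nonneg sum_UNIV_block, rule sum.swap)
  ultimately show ?thesis
    by (simp add: sum_distrib_left)
qed

text \<open>The preimage is \<open>J h / 4\<close>, as \<open>J\<^sup>H J = 4 I\<close>.\<close>

lemma unmix_surj_real:
  obtains x where "\<And>m a. unmix x m a = of_real (h m a)"
proof
  fix m a
  let ?x = "\<chi> r. (1/4) *\<^sub>R (\<Sum>b\<in>UNIV. h (snd r) b *\<^sub>R unit_rot (fst r) b)"
  show "unmix ?x m a = of_real (h m a)"
    unfolding unmix_def sum_qidx unit_rot_eq
    by (cases a) (simp_all add: quat_unit_simps of_real_def)
qed

lemma loewner_ge_scaled_identity_iff:
  fixes A :: "quat^'m^'m::finite"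
  shows "A \<succeq>\<^sub>L c *\<^sub>R mat 1 \<longleftrightarrow> (\<forall>x. c * (norm x)\<^sup>2 \<le> qa (hdot x (A *v x)))"
proof -
  have "hdot x ((c *\<^sub>R mat 1) *v x) = of_real (c * (norm x)\<^sup>2)" for x :: "quat^'m"
  proof -
    have "(c *\<^sub>R mat 1) *v x = c *\<^sub>R x"
      by (simp add: vec_eq_iff matrix_vector_mult_def mat_def if_distrib if_distribR cong: if_cong)
    moreover have "hdot x (c *\<^sub>R x) = c *\<^sub>R hdot x x"
      by (simp add: hdot_def scaleR_sum_right)
    ultimately show ?thesis
      by (simp add: hdot_self scaleR_conv_of_real)
  qed
  moreover have "hdot x ((A - B) *v x) = hdot x (A *v x) - hdot x (B *v x)" for x and B :: "quat^'m^'m"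
    by (simp add: matrix_vector_mult_diff_rdistrib hdot_def right_diff_distrib sum_subtractf)
  ultimately have "A \<succeq>\<^sub>L c *\<^sub>R mat 1 \<longleftrightarrow>
      (\<forall>x. x \<noteq> 0 \<longrightarrow> c * (norm x)\<^sup>2 \<le> qa (hdot x (A *v x)))"
    by (simp add: loewner_ge_def quat_psd_def of_real_def)
  moreover have "qa (hdot 0 (A *v 0)) = 0"
    by (simp add: hdot_def qa_sum)
  ultimately show ?thesis
    by (metis mult_zero_right norm_zero order_refl power_zero_numeral)
qed

text \<open>From left to right, real vectors are special quaternion vectors. From right to left, the form
  at a quaternion vector is the sum of its values at the four real component vectors, because the
  inner product of quaternions is a sum over components.\<close>

lemma quadratic_form_bound_quat_iff_real:
  fixes R :: "'n::finite \<Rightarrow> qidx \<Rightarrow> 'n \<Rightarrow> qidx \<Rightarrow> real"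
  shows "(\<forall>x :: quat^(qidx \<times> 'n).
      \<sigma> * (\<Sum>m\<in>UNIV. \<Sum>a\<in>UNIV. (norm (unmix x m a))\<^sup>2) \<le>
      (\<Sum>m\<in>UNIV. \<Sum>a\<in>UNIV. \<Sum>l\<in>UNIV. \<Sum>b\<in>UNIV. R m a l b * (unmix x m a \<bullet> unmix x l b))) \<longleftrightarrow>
    (\<forall>v :: quat^'n. \<sigma> * (norm v)\<^sup>2 \<le> (\<Sum>m\<in>UNIV. \<Sum>a\<in>UNIV. \<Sum>l\<in>UNIV. \<Sum>b\<in>UNIV.
      (v \<bullet> coord_dir m a) * (v \<bullet> coord_dir l b) * R m a l b))"
    (is "?L \<longleftrightarrow> ?V")
proof -
  have norm_coords: "(norm v)\<^sup>2 = (\<Sum>m\<in>UNIV. \<Sum>a\<in>UNIV. (v \<bullet> coord_dir m a)\<^sup>2)" for v :: "quat^'n"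
    unfolding power2_norm_eq_inner euclidean_inner[of v v] sum_Basis_quat_vec
    by (simp add: power2_eq_square)
  have parseval_norm: "(norm p)\<^sup>2 = (\<Sum>c\<in>UNIV. (p \<bullet> qunit c)\<^sup>2)" for p :: quat
    by (simp add: norm_quat_def sum_qidx inner_quat_def quat_unit_simps)
  show ?thesis
  proof
    assume L: ?L
    show ?V
    proof
      fix v :: "quat^'n"
      obtain x :: "quat^(qidx \<times> 'n)" where x: "\<And>m a. unmix x m a = of_real (v \<bullet> coord_dir m a)"
        using unmix_surj_real[of "\<lambda>m a. v \<bullet> coord_dir m a"] by blast
      have "(of_real s :: quat) \<bullet> of_real t = s * t" for s t
        by (simp add: inner_quat_def of_real_def)
      with L[rule_format, of x] show "\<sigma> * (norm v)\<^sup>2 \<le> (\<Sum>m\<in>UNIV. \<Sum>a\<in>UNIV. \<Sum>l\<in>UNIV. \<Sum>b\<in>UNIV.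
          (v \<bullet> coord_dir m a) * (v \<bullet> coord_dir l b) * R m a l b)"
        by (simp add: x norm_coords mult.commute)
    qed
  next
    assume V: ?V
    show ?L
    proof
      fix x :: "quat^(qidx \<times> 'n)"
      have parseval: "unmix x m a \<bullet> unmix x l b =
          (\<Sum>c\<in>UNIV. (unmix x m a \<bullet> qunit c) * (unmix x l b \<bullet> qunit c))" for m a l b
        by (simp add: sum_qidx inner_quat_def quat_unit_simps)
      let ?h = "\<lambda>c m a. unmix x m a \<bullet> qunit c"
      have V': "\<sigma> * (\<Sum>m\<in>UNIV. \<Sum>a\<in>UNIV. (?h c m a)\<^sup>2) \<le>
          (\<Sum>m\<in>UNIV. \<Sum>a\<in>UNIV. \<Sum>l\<in>UNIV. \<Sum>b\<in>UNIV. ?h c m a * ?h c l b * R m a l b)" for c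
      proof -
        define v where "v = (\<chi> m. \<Sum>a\<in>UNIV. ?h c m a *\<^sub>R qunit a)"
        have "v \<bullet> coord_dir m a = ?h c m a" for m a
          by (cases a) (simp_all add: v_def inner_axis sum_qidx inner_quat_def quat_unit_simps)
        thus ?thesis
          using V[rule_format, of v] by (simp add: norm_coords)
      qed
      have "\<sigma> * (\<Sum>m\<in>UNIV. \<Sum>a\<in>UNIV. (norm (unmix x m a))\<^sup>2) =
          (\<Sum>c\<in>UNIV. \<sigma> * (\<Sum>m\<in>UNIV. \<Sum>a\<in>UNIV. (?h c m a)\<^sup>2))"
        by (simp only: parseval_norm sum_distrib_left)
           (rule sym, rule trans[OF sum.swap], rule sum.cong[OF refl], rule sum.swap)
      also have "\<dots> \<le> (\<Sum>c\<in>UNIV. \<Sum>m\<in>UNIV. \<Sum>a\<in>UNIV. \<Sum>l\<in>UNIV. \<Sum>b\<in>UNIV. ?h c m a * ?h c l b * R m a l b)"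
        by (intro sum_mono V')
      also have "\<dots> = (\<Sum>m\<in>UNIV. \<Sum>a\<in>UNIV. \<Sum>l\<in>UNIV. \<Sum>b\<in>UNIV. R m a l b * (unmix x m a \<bullet> unmix x l b))"
        by (rule trans[OF sum.swap], rule sum.cong[OF refl])+
           (simp add: parseval sum_distrib_left mult_ac)
      finally show "\<sigma> * (\<Sum>m\<in>UNIV. \<Sum>a\<in>UNIV. (norm (unmix x m a))\<^sup>2) \<le> \<dots>" .
    qed
  qed
qed

theorem mainTheorem6:
  fixes C :: "(quat^'n::finite) set" and f :: "quat^'n \<Rightarrow> real" and \<sigma> :: real
  assumes "convex C" and "real_C2_on C f" and "\<sigma> > 0"
  shows "strongly_convex_on \<sigma> C f \<longleftrightarrow>
    (\<forall>q\<in>C. aug_hessian f q \<succeq>\<^sub>L (\<sigma> / 4) *\<^sub>R mat 1)"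
proof -
  have "aug_hessian f q \<succeq>\<^sub>L (\<sigma> / 4) *\<^sub>R mat 1 \<longleftrightarrow>
    (\<forall>v. \<sigma> * (norm v)\<^sup>2 \<le> (\<Sum>m\<in>UNIV. \<Sum>a\<in>UNIV. \<Sum>l\<in>UNIV. \<Sum>b\<in>UNIV.
      (v \<bullet> coord_dir m a) * (v \<bullet> coord_dir l b) * real_partial (real_partial f m a) l b q))"
    if "q \<in> C" for q
    unfolding loewner_ge_scaled_identity_iff aug_hessian_quadratic_form[OF assms(1,2) that]
      quadratic_form_bound_quat_iff_real[symmetric] sum_norm_unmix
    by (simp add: field_simps)
  thus ?thesis
    unfolding strongly_convex_on_iff_real_partials[OF assms(1,2)] by blast
qed

end
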